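(* Let $\mathbf{A}\in\mathbb{R}^{N\times N}$ be any diagonalizable graph adjacency matrix, with eigendecomposition $\mathbf{A}=\mathbf{V}\boldsymbol{\Lambda}\mathbf{V}^{-1}$, and let $\mathbf{A}_\phi=\mathbf{V}\boldsymbol{\Lambda}_\phi\mathbf{V}^{-1}$ be an associated graph shift operator. Then $\mathbf{A}$ is a linear shift invariant (LSI) filter under $\mathbf{A}_\phi$, i.e. $\mathbf{A}\mathbf{A}_\phi\mathbf{x}=\mathbf{A}_\phi\mathbf{A}\mathbf{x}$ for every $\mathbf{x}\in\mathbb{C}^N$.
   Context: A graph on $N$ nodes is given by a real weighted adjacency matrix $\mathbf{A}\in\mathbb{R}^{N\times N}$ (directed or undirected), assumed diagonalizable (over $\mathbb{C}$), $\mathbf{A}=\mathbf{V}\boldsymbol{\Lambda}\mathbf{V}^{-1}$ with $\mathbf{V}\in\mathbb{C}^{N\times N}$ invertible and $\boldsymbol{\Lambda}$ diagonal. Graph shift operator: $\mathbf{A}_\phi=\mathbf{V}\boldsymbol{\Lambda}_\phi\mathbf{V}^{-1}$ with $\boldsymbol{\Lambda}_\phi=\mathrm{diag}(e^{j\phi_1},\dots,e^{j\phi_N})$, where $j=\sqrt{-1}$ and $\phi_1,\dots,\phi_N\in[0,2\pi]$ are arbitrary phases with $\phi_k\ne\phi_l$ for $k\neq l$. LSI filter: a matrix $\mathbf{H}\in\mathbb{C}^{N\times N}$ (acting on graph signals $\mathbf{x}\in\mathbb{C}^N$ by $\mathbf{x}\mapsto\mathbf{H}\mathbf{x}$) is linear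 shift invariant under $\mathbf{A}_\phi$ if $\mathbf{H}\mathbf{A}_\phi\mathbf{x}=\mathbf{A}_\phi\mathbf{H}\mathbf{x}$ for all $\mathbf{x}\in\mathbb{C}^N$. *)

theory Defs
  imports "HOL-Analysis.Analysis"
begin

definition diag_matrix :: "complex^'n \<Rightarrow> complex^'n^'n" where
  "diag_matrix d = (\<chi> k l. if k = l then d $ k else 0)"

definition is_eigendecomposition ::
    "real^'n^'n \<Rightarrow> complex^'n^'n \<Rightarrow> complex^'n \<Rightarrow> bool" where
  "is_eigendecomposition A V lam \<longleftrightarrow>
     invertible V \<and> map_matrix complex_of_real A = V ** diag_matrix lam ** matrix_inv V"

text \<open>The endpoints \<open>0\<close> and \<open>2 * pi\<close> are both admitted, and it is the phases,
  not the numbers \<open>exp (\<i> * \<phi>\<^sub>k)\<close>, that are required to be pairwise distinct.\<close>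

definition admissible_phases :: "real^'n \<Rightarrow> bool" where
  "admissible_phases phi \<longleftrightarrow>
     (\<forall>k. phi $ k \<in> {0..2 * pi}) \<and> (\<forall>k l. k \<noteq> l \<longrightarrow> phi $ k \<noteq> phi $ l)"

definition graph_shift :: "complex^'n^'n \<Rightarrow> real^'n \<Rightarrow> complex^'n^'n" where
  "graph_shift V phi =
     V ** diag_matrix (\<chi> k. exp (\<i> * complex_of_real (phi $ k))) ** matrix_inv V"

definition LSI_filter :: "complex^'n^'n \<Rightarrow> complex^'n^'n \<Rightarrow> bool" where
  "LSI_filter S H \<longleftrightarrow> (\<forall>x. H *v (S *v x) = S *v (H *v x))"

end

theory Submission
  imports Defs
begin

text \<open>\<open>A\<close> and the shift are conjugates of diagonal matrices by the same
  \<open>V\<close>. Conjugation respects products (\<open>conjugate_matrix_mult\<close>), so they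
  commute because diagonal matrices do: those multiply entrywise
  (\<open>diag_matrix_mult\<close>).\<close>

lemma diag_matrix_mult:
  "diag_matrix c ** diag_matrix d = diag_matrix (\<chi> k. c $ k * d $ k)"
  by (simp add: diag_matrix_def matrix_matrix_mult_def vec_eq_iff mult_delta_left)

lemma conjugate_matrix_mult:
  fixes V :: "'a::semiring_1^'n^'n"
  assumes "invertible V"
  shows "(V ** C ** matrix_inv V) ** (V ** D ** matrix_inv V) = V ** (C ** D) ** matrix_inv V"
proof -
  \<comment> \<open>\<open>matrix_inv\<close> is a Hilbert choice of a two-sided inverse;
    invertibility makes the choice genuine.\<close>
  have "matrix_inv V ** V = mat 1"
    using assms unfolding invertible_def matrix_inv_def by (rule someI2_ex) simp
  \<comment> \<open>The trailing \<open>X\<close> lets the cancellation fire inside right-nested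
    products.\<close>
  then have "matrix_inv V ** (V ** X) = X" for X :: "'a^'n^'n"
    by (simp only: matrix_mul_assoc matrix_mul_lid)
  then show ?thesis
    by (simp only: matrix_mul_assoc [symmetric])
qed

theorem theorem2:
  fixes A :: "real^'n^'n" and V :: "complex^'n^'n"
    and lam :: "complex^'n" and phi :: "real^'n"
  assumes "is_eigendecomposition A V lam"
    and "admissible_phases phi"
  shows "LSI_filter (graph_shift V phi) (map_matrix complex_of_real A)"
proof -
  have "invertible V"
    and A: "map_matrix complex_of_real A = V ** diag_matrix lam ** matrix_inv V"
    using assms(1) by (simp_all add: is_eigendecomposition_def)
  then have "map_matrix complex_of_real A ** graph_shift V phi
      = graph_shift V phi ** map_matrix complex_of_real A"
    unfolding A graph_shift_def
    \<comment> \<open>\<open>mult.commute\<close> acts on the complex diagonal entries, the only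
      place where the two products differ.\<close>
    by (simp only: conjugate_matrix_mult diag_matrix_mult mult.commute)
  then show ?thesis
    by (simp add: LSI_filter_def matrix_vector_mul_assoc)
qed

end
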